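(* Let $T>0$, $\Delta f=1/T$, and let $M,N$ be positive integers. For $k=0,1,\dots,N-1$ and $l=0,1,\dots,M-1$ let $$\alpha_{(k,l)}(t)=\sqrt{\frac{T}{MN}}\sum_{n=0}^{N-1}e^{j2\pi\frac{nk}{N}}\int_0^{M\Delta f}e^{j2\pi f\left(t-\frac{lT}{M}-nT\right)}\,df,\qquad t\in\mathbb{R}.$$ Then $\boldsymbol{\alpha}=\{\alpha_{(k,l)}(t)\}_{k=0,\dots,N-1,\;l=0,\dots,M-1}$ is an $MN$-dimensional orthonormal basis (i.e. an orthonormal family of $MN$ signals, spanning an $MN$-dimensional space): for all $k_1,k_2\in\{0,\dots,N-1\}$ and $l_1,l_2\in\{0,\dots,M-1\}$, $$\int_{-\infty}^{\infty}\alpha_{(k_1,l_1)}(t)\,\alpha^*_{(k_2,l_2)}(t)\,dt=\delta[k_1-k_2]\,\delta[l_1-l_2].$$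
   Context: Here $j=\sqrt{-1}$, $^*$ denotes complex conjugation, and $\delta[k]$ for $k\in\mathbb{Z}$ is the discrete impulse: $\delta[0]=1$ and $\delta[k]=0$ for $k\ne0$. *)

theory Defs
  imports "HOL-Analysis.Analysis" "HOL-Library.Function_Algebras"
begin

definition impulse :: "int \<Rightarrow> complex" where
  "impulse k = (if k = 0 then 1 else 0)"

definition alpha :: "real \<Rightarrow> real \<Rightarrow> nat \<Rightarrow> nat \<Rightarrow> nat \<Rightarrow> nat \<Rightarrow> real \<Rightarrow> complex" where
  "alpha T \<Delta>f M N k l t =
     complex_of_real (sqrt (T / (real M * real N))) *
     (\<Sum>n = 0..N - 1.
        exp (\<i> * 2 * of_real pi * of_real (real n * real k / real N)) *
        (CLBINT f = 0..ereal (real M * \<Delta>f).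
           exp (\<i> * 2 * of_real pi * of_real f *
                of_real (t - real l * T / real M - real n * T))))"

(* Signals are functions on the real line, not classes modulo null sets. Functions that are
   orthonormal for the L2 inner product are linearly independent in either reading. *)
definition signal_scale :: "complex \<Rightarrow> (real \<Rightarrow> complex) \<Rightarrow> real \<Rightarrow> complex" where
  "signal_scale c x = (\<lambda>t. c * x t)"

interpretation signal: vector_space signal_scale
  by unfold_locales (auto simp: signal_scale_def fun_eq_iff algebra_simps)

end

theory Submission
  imports Defs "HOL-Probability.Sinc_Integral"
begin

text \<open>
  Put \<open>B = M / T\<close>. The inner integral is \<open>pulse B s = B sinc (\<pi> B s) cis (\<pi> B s)\<close>, and the delay
  \<open>l T / M + n T\<close> is the integer multiple \<open>(l + n M) / B\<close> of the sampling period. Shifts of \<open>sinc\<close> by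
  integer multiples of \<open>\<pi>\<close> are orthogonal, so distinct pairs \<open>(l, n)\<close> contribute orthogonal pulses of
  energy \<open>B\<close>, and what remains is the orthogonality of the characters of \<open>\<int>/N\<close>.

  For the shifts of \<open>sinc\<close>, partial fractions turn the product of two of them, at \<open>u \<noteq> v\<close>, into a multiple
  of \<open>h u - h v\<close> with \<open>h u = (sin u)\<^sup>2 / u\<close>. As \<open>h\<close> vanishes at infinity, the mean value theorem
  shows that so does the antiderivative of this difference. The square of \<open>sinc\<close> has the antiderivative
  \<open>Si (2 x) - (sin x)\<^sup>2 / x\<close>.
\<close>

text \<open>The library's \<open>sinc\<close> is an abbreviation of a conditional, which the simplifier would split.\<close>

definition cardinal_sine :: "real \<Rightarrow> real" where
  "cardinal_sine x = sinc x"

lemma cardinal_sine_0 [simp]: "cardinal_sine 0 = 1"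
  by (simp add: cardinal_sine_def)

lemma cardinal_sine_nonzero: "x \<noteq> 0 \<Longrightarrow> cardinal_sine x = sin x / x"
  by (simp add: cardinal_sine_def)

lemma cardinal_sine_mult_self: "cardinal_sine x * x = sin x"
  by (simp add: cardinal_sine_def)

lemma isCont_cardinal_sine: "isCont cardinal_sine x"
  unfolding cardinal_sine_def[abs_def] by (rule isCont_sinc)

lemma continuous_cardinal_sine [continuous_intros]:
  "continuous (at x within S) f \<Longrightarrow> continuous (at x within S) (\<lambda>x. cardinal_sine (f x))"
  by (rule continuous_within_compose3[OF isCont_cardinal_sine])

lemma borel_measurable_cardinal_sine [measurable]: "cardinal_sine \<in> borel_measurable borel"
  unfolding cardinal_sine_def[abs_def] by (rule borel_measurable_sinc)

section \<open>The function (sin x)^2 / x and the energy of sinc\<close>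

lemma abs_sin_mult_cardinal_sine_le:
  "\<bar>sin x * cardinal_sine x\<bar> \<le> 1 / \<bar>x\<bar>" if "x \<noteq> 0"
proof -
  have "\<bar>sin x\<bar> * \<bar>sin x\<bar> \<le> 1 * 1"
    by (intro mult_mono) auto
  with that show ?thesis
    by (simp add: cardinal_sine_nonzero abs_mult divide_right_mono)
qed

lemma sin_mult_cardinal_sine_at_infinity:
  "((\<lambda>x. sin x * cardinal_sine x) \<longlongrightarrow> 0) at_infinity"
proof (rule Lim_null_comparison)
  show "\<forall>\<^sub>F x in at_infinity. norm (sin x * cardinal_sine x) \<le> norm (inverse x)"
    using eventually_not_equal_at_infinity[of "0::real"]
    by eventually_elim (use abs_sin_mult_cardinal_sine_le in \<open>auto simp: inverse_eq_divide\<close>)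
  show "((\<lambda>x::real. norm (inverse x)) \<longlongrightarrow> 0) at_infinity"
    using tendsto_inverse_0 by (rule tendsto_norm_zero)
qed

text \<open>The term \<open>2 * cardinal_sine (2 * x)\<close> is also the derivative of
  \<open>Si (2 * x)\<close>, so subtracting the two functions leaves an antiderivative of the
  square. Away from 0 this is the quotient rule and the double angle formula.\<close>

lemma DERIV_sin_mult_cardinal_sine:
  "((\<lambda>x. sin x * cardinal_sine x) has_real_derivative
     2 * cardinal_sine (2 * x) - (cardinal_sine x)\<^sup>2) (at x)"
proof (cases "x = 0")
  case True
  \<comment> \<open>The function vanishes at 0, and its difference quotient there is the square of
    sinc, which tends to 1 = 2 - 1.\<close>
  have "((\<lambda>h. cardinal_sine h * cardinal_sine h) \<longlongrightarrow> 1 * 1) (at 0)"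
    using isCont_cardinal_sine[of 0] by (intro tendsto_mult) (auto simp: isCont_def)
  moreover have "\<forall>\<^sub>F h in at 0. cardinal_sine h * cardinal_sine h = (sin h * cardinal_sine h) / h"
    by (auto simp: eventually_at_filter cardinal_sine_nonzero)
  ultimately have "((\<lambda>h. (sin h * cardinal_sine h) / h) \<longlongrightarrow> 1) (at 0)"
    by (simp add: Lim_transform_eventually)
  with True show ?thesis
    by (simp add: DERIV_def)
next
  case False
  have "sin (x * 2) = 2 * sin x * cos x"
    using sin_double[of x] by (simp only: mult.commute[of x 2])
  with False have "((\<lambda>x. sin x * (sin x / x)) has_real_derivative
     2 * cardinal_sine (2 * x) - (cardinal_sine x)\<^sup>2) (at x)"
    by (auto intro!: derivative_eq_intros
        simp: cardinal_sine_nonzero field_simps power2_eq_square)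
  then show ?thesis
  proof (rule DERIV_cong_ev[THEN iffD1, OF refl _ refl, rotated])
    show "\<forall>\<^sub>F y in nhds x. sin y * (sin y / y) = sin y * cardinal_sine y"
      using t1_space_nhds[OF False] by eventually_elim (simp add: cardinal_sine_nonzero)
  qed
qed

lemma
  shows integrable_cardinal_sine_square: "integrable lborel (\<lambda>x. (cardinal_sine x)\<^sup>2)"
    and LBINT_cardinal_sine_square: "(LBINT x. (cardinal_sine x)\<^sup>2) = pi"
proof -
  define F where "F x = Si (2 * x) - sin x * cardinal_sine x" for x
  have deriv: "(F has_real_derivative (cardinal_sine x)\<^sup>2) (at x)" for x
  proof -
    have "((\<lambda>x. Si (2 * x)) has_real_derivative cardinal_sine (2 * x) * 2) (at x)"
      unfolding cardinal_sine_def
      by (rule DERIV_chain2[OF DERIV_Si]) (auto intro!: derivative_eq_intros)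
    from DERIV_diff[OF this DERIV_sin_mult_cardinal_sine[of x]] show ?thesis
      by (simp add: F_def[abs_def])
  qed
  have top: "(F \<longlongrightarrow> pi / 2) at_top"
  proof -
    have "((\<lambda>x. Si (2 * x)) \<longlongrightarrow> pi / 2) at_top"
      by (rule filterlim_compose[OF Si_at_top])
         (auto intro!: filterlim_tendsto_pos_mult_at_top filterlim_ident)
    from tendsto_diff[OF this tendsto_mono[OF at_top_le_at_infinity sin_mult_cardinal_sine_at_infinity]]
    show ?thesis by (simp add: F_def[abs_def])
  qed
  have bot: "(F \<longlongrightarrow> - (pi / 2)) at_bot"
  proof -
    \<comment> \<open>\<open>F\<close> is odd, so its limit at the bottom mirrors the one at the
      top. \<open>Si_neg\<close> covers nonnegative arguments, enough near
      \<open>at_top\<close>.\<close>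
    have "\<forall>\<^sub>F x in at_top. - F x = F (- x)"
      using eventually_ge_at_top[of 0]
      by eventually_elim (use Si_neg in \<open>auto simp: F_def cardinal_sine_def\<close>)
    from Lim_transform_eventually[OF tendsto_minus[OF top] this] show ?thesis
      by (simp add: filterlim_at_bot_mirror)
  qed
  \<comment> \<open>The integrand is nonnegative, so the limits of \<open>F\<close> at both ends
    give integrability along with the value.\<close>
  have "set_integrable lborel (einterval (-\<infinity>) \<infinity>) (\<lambda>x. (cardinal_sine x)\<^sup>2)"
    and "(LBINT x=-\<infinity>..\<infinity>. (cardinal_sine x)\<^sup>2) = pi / 2 - (- (pi / 2))"
    by (rule interval_integral_FTC_nonneg[where F = F];
        use deriv top bot in \<open>auto simp: ereal_tendsto_simps intro!: isCont_power isCont_cardinal_sine\<close>)+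
  then show "integrable lborel (\<lambda>x. (cardinal_sine x)\<^sup>2)"
    and "(LBINT x. (cardinal_sine x)\<^sup>2) = pi"
    by (auto simp: set_integrable_def interval_lebesgue_integral_def set_lebesgue_integral_def)
qed

section \<open>Orthogonality of the shifts of sinc by integer multiples of pi\<close>

lemma integrable_cardinal_sine_mult_shift:
  "integrable lborel (\<lambda>x. cardinal_sine (x - a) * cardinal_sine (x - b))"
proof (rule Bochner_Integration.integrable_bound)
  have shift: "integrable lborel (\<lambda>x. (cardinal_sine (x - c))\<^sup>2)" for c
    using lborel_integrable_real_affine[OF integrable_cardinal_sine_square, of 1 "- c"]
    by simp
  then show "integrable lborel (\<lambda>x. (cardinal_sine (x - a))\<^sup>2 + (cardinal_sine (x - b))\<^sup>2)"
    by (intro Bochner_Integration.integrable_add)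
  have "norm (u * v) \<le> norm (u\<^sup>2 + v\<^sup>2)" for u v :: real
    using sum_squares_bound[of "\<bar>u\<bar>" "\<bar>v\<bar>"] abs_ge_zero[of "u * v"]
    unfolding abs_mult real_norm_def by (simp; linarith)
  then show "AE x in lborel. norm (cardinal_sine (x - a) * cardinal_sine (x - b))
      \<le> norm ((cardinal_sine (x - a))\<^sup>2 + (cardinal_sine (x - b))\<^sup>2)"
    by blast
qed measurable

lemma sin_minus_pi_int: "sin (x - pi * of_int p) = (if even p then 1 else - 1) * sin x"
  by (simp add: sin_diff)

text \<open>By the mean value theorem the difference is \<open>b - a\<close> times a value of
  \<open>h\<close> between \<open>x - a\<close> and \<open>x - b\<close>, and that point escapes to
  infinity with \<open>x\<close>.\<close>

lemma antiderivative_difference_at_infinity: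
  fixes h H :: "real \<Rightarrow> real"
  assumes deriv: "\<And>x. (H has_real_derivative h x) (at x)"
    and h: "(h \<longlongrightarrow> 0) at_infinity"
  shows "((\<lambda>x. H (x - a) - H (x - b)) \<longlongrightarrow> 0) at_infinity"
proof (cases "a = b")
  case False
  show ?thesis
  proof (rule tendstoI)
    fix e :: real assume "e > 0"
    define d where "d = e / \<bar>b - a\<bar>"
    have "d > 0" using \<open>e > 0\<close> False by (simp add: d_def)
    with h have "\<forall>\<^sub>F x in at_infinity. norm (h x) < d"
      by (auto dest: tendstoD)
    then obtain R where R: "\<And>x. norm x \<ge> R \<Longrightarrow> norm (h x) < d"
      by (auto simp: eventually_at_infinity)
    \<comment> \<open>This margin keeps every point between \<open>x - a\<close> and
      \<open>x - b\<close> at absolute value at least \<open>R\<close>.\<close>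
    have "\<forall>\<^sub>F x in at_infinity. norm (x::real) \<ge> R + \<bar>a\<bar> + \<bar>b\<bar>"
      by (auto simp: eventually_at_infinity)
    then show "\<forall>\<^sub>F x in at_infinity. dist (H (x - a) - H (x - b)) 0 < e"
    proof eventually_elim
      case (elim x)
      \<comment> \<open>Stated for ordered endpoints, so that it serves both \<open>a < b\<close>
        and \<open>b < a\<close>.\<close>
      have "norm (H u - H v) < e"
        if "u < v" "\<bar>v - u\<bar> = \<bar>b - a\<bar>" "\<And>z. u < z \<Longrightarrow> z < v \<Longrightarrow> \<bar>z\<bar> \<ge> R" for u v
      proof -
        obtain z where z: "u < z" "z < v" "H v - H u = (v - u) * h z"
          using MVT2[OF \<open>u < v\<close>, of H h] deriv by blast
        have "norm (h z) < d" using R that z by auto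
        then have "\<bar>b - a\<bar> * norm (h z) < e"
          using False by (simp add: d_def field_simps)
        moreover have "norm (H u - H v) = \<bar>b - a\<bar> * norm (h z)"
          using z(3) that(1,2) by (simp add: abs_minus_commute[of "H u"] abs_mult)
        ultimately show ?thesis by simp
      qed
      from this[of "x - a" "x - b"] this[of "x - b" "x - a"] False elim show ?case
        by (cases "a < b") (auto simp: dist_norm abs_minus_commute)
    qed
  qed
qed simp

lemma LBINT_cardinal_sine_shift_orthogonal:
  fixes p q :: int
  assumes "p \<noteq> q"
  shows "(LBINT x. cardinal_sine (x - pi * p) * cardinal_sine (x - pi * q)) = 0"
proof -
  define h where "h u = sin u * cardinal_sine u" for u
  \<comment> \<open>The sign (-1)^(p - q) relating the two shifted sines; \<open>p + q\<close> has
    the parity of \<open>p - q\<close>.\<close>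
  define e :: real where "e = (if even (p + q) then 1 else - 1)"
  define s where "s = e / (pi * (p - q))"
  have split: "cardinal_sine (x - pi * p) * cardinal_sine (x - pi * q)
      = s * (h (x - pi * p) - h (x - pi * q))" for x
  proof -
    let ?u = "x - pi * p" and ?v = "x - pi * q"
    have e: "sin ?v = e * sin ?u" "sin ?u = e * sin ?v"
      by (auto simp: sin_minus_pi_int e_def)
    \<comment> \<open>Partial fractions in multiplied form: \<open>cardinal_sine_mult_self\<close>
      also holds at 0, so the removable singularities need no separate case. The factor
      \<open>?v - ?u\<close> is the nonzero constant \<open>pi * (p - q)\<close>.\<close>
    have "cardinal_sine ?u * cardinal_sine ?v * (?v - ?u)
        = cardinal_sine ?u * (cardinal_sine ?v * ?v) - cardinal_sine ?v * (cardinal_sine ?u * ?u)"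
      by (simp add: algebra_simps)
    also have "\<dots> = cardinal_sine ?u * (e * sin ?u) - cardinal_sine ?v * (e * sin ?v)"
      unfolding cardinal_sine_mult_self using e by simp
    also have "\<dots> = e * (h ?u - h ?v)"
      by (simp add: h_def algebra_simps)
    finally have "cardinal_sine ?u * cardinal_sine ?v * (pi * (p - q)) = e * (h ?u - h ?v)"
      by (simp add: algebra_simps)
    with assms show ?thesis
      by (simp add: s_def field_simps)
  qed
  have cont: "isCont h x" for x
    unfolding h_def[abs_def] by (intro continuous_intros)
  obtain H where "\<And>x. (H has_vector_derivative h x) (at x)"
    using einterval_antiderivative[of "-\<infinity>" \<infinity> h] cont by auto
  then have H: "(H has_real_derivative h x) (at x)" for x
    by (simp add: has_real_derivative_iff_has_vector_derivative)
  define F where "F x = s * (H (x - pi * p) - H (x - pi * q))" for x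
  have "(F has_real_derivative cardinal_sine (x - pi * p) * cardinal_sine (x - pi * q)) (at x)" for x
    unfolding F_def[abs_def] split
    by (auto intro!: derivative_eq_intros DERIV_chain2[OF H])
  then have deriv: "(F has_vector_derivative cardinal_sine (x - pi * p) * cardinal_sine (x - pi * q)) (at x)" for x
    by (simp add: has_real_derivative_iff_has_vector_derivative)
  have "(F \<longlongrightarrow> 0) at_infinity"
    unfolding F_def[abs_def]
    using antiderivative_difference_at_infinity[OF H sin_mult_cardinal_sine_at_infinity[folded h_def]]
    by (rule tendsto_mult_right_zero)
  then have lim: "(F \<longlongrightarrow> 0) at_top" "(F \<longlongrightarrow> 0) at_bot"
    by (auto intro: tendsto_mono at_top_le_at_infinity at_bot_le_at_infinity)
  \<comment> \<open>The integrand changes sign, so this version of the fundamental theorem takes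
    integrability as a premise.\<close>
  have "(LBINT x=-\<infinity>..\<infinity>. cardinal_sine (x - pi * p) * cardinal_sine (x - pi * q)) = 0 - 0"
    by (rule interval_integral_FTC_integrable[where F = F])
       (use deriv lim integrable_cardinal_sine_mult_shift in
         \<open>auto simp: ereal_tendsto_simps set_integrable_def intro!: continuous_intros\<close>)
  then show ?thesis
    by (simp add: interval_lebesgue_integral_def set_lebesgue_integral_def)
qed

lemma LBINT_cardinal_sine_shift:
  fixes p q :: int
  shows "(LBINT x. cardinal_sine (x - pi * p) * cardinal_sine (x - pi * q)) = (if p = q then pi else 0)"
proof (cases "p = q")
  case True
  then show ?thesis
    using lborel_integral_real_affine[of 1 "\<lambda>x. (cardinal_sine x)\<^sup>2" "- (pi * p)"]
    by (simp add: LBINT_cardinal_sine_square power2_eq_square[symmetric])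
qed (simp add: LBINT_cardinal_sine_shift_orthogonal)

section \<open>The band-limited pulse and its shifts\<close>

definition pulse :: "real \<Rightarrow> real \<Rightarrow> complex" where
  "pulse B s = (CLBINT f = 0..ereal B. exp (\<i> * 2 * of_real pi * of_real f * of_real s))"

lemma pulse_eq: "pulse B s = of_real (B * cardinal_sine (pi * B * s)) * cis (pi * B * s)"
proof (cases "s = 0")
  case True
  have "(CLBINT f = ereal 0..ereal B. 1) = of_real B - of_real 0"
    by (rule interval_integral_FTC_finite)
       (auto intro!: has_vector_derivative_of_real derivative_eq_intros)
  with True show ?thesis
    by (simp add: pulse_def zero_ereal_def)
next
  case False
  define F where "F f = exp (\<i> * 2 * of_real pi * of_real f * of_real s) / (\<i> * 2 * of_real pi * of_real s)" for f :: real
  have "pulse B s = F B - F 0"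
    unfolding pulse_def zero_ereal_def F_def
    by (rule interval_integral_FTC_finite)
       (use False in \<open>auto intro!: continuous_intros derivative_eq_intros
           has_vector_derivative_real_field\<close>)
  also have "\<dots> = (cis (pi * B * s) * cis (pi * B * s) - 1) / (\<i> * 2 * of_real pi * of_real s)"
  proof -
    have "exp (\<i> * 2 * of_real pi * of_real B * of_real s) = cis (pi * B * s) * cis (pi * B * s)"
      by (simp add: cis_conv_exp mult_exp_exp mult_ac)
    then show ?thesis
      by (simp add: F_def diff_divide_distrib)
  qed
  also have "\<dots> = of_real (B * cardinal_sine (pi * B * s)) * cis (pi * B * s)"
  proof (cases "B = 0")
    case B: False
    \<comment> \<open>Factoring out the half angle leaves a sine, whose quotient by
      \<open>pi * s\<close> is \<open>B\<close> times sinc.\<close>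
    have "cis x * cis x - 1 = 2 * \<i> * sin x * cis x" for x
      using sin_cos_squared_add3[of x] by (simp add: complex_eq_iff algebra_simps)
    with False B show ?thesis
      by (simp add: cardinal_sine_nonzero field_simps)
  qed simp
  finally show ?thesis .
qed

text \<open>The substitution x = pi B t turns the delays \<open>p / B\<close> and
  \<open>q / B\<close> into shifts of sinc by pi p and pi q. The phases depending on
  \<open>t\<close> cancel against the conjugate, leaving the constant
  \<open>cis (pi * (q - p))\<close>. For \<open>p = q\<close> the value is B^2 * pi / (pi B) =
  B.\<close>

lemma
  fixes p q :: int
  assumes "B > 0"
  shows integrable_pulse_shift:
      "integrable lborel (\<lambda>t. pulse B (t - p / B) * cnj (pulse B (t - q / B)))"
    and CLBINT_pulse_shift:
      "(CLBINT t. pulse B (t - p / B) * cnj (pulse B (t - q / B))) = (if p = q then of_real B else 0)"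
proof -
  define g where "g x = cardinal_sine (x - pi * p) * cardinal_sine (x - pi * q)" for x
  \<comment> \<open>The summand 0 gives the argument the affine shape of the substitution rules;
    \<open>del: add_0\<close> preserves it below.\<close>
  have eq: "pulse B (t - p / B) * cnj (pulse B (t - q / B))
      = of_real (g (0 + pi * B * t)) * (B\<^sup>2 * cis (pi * (q - p)))" for t
  proof -
    have "pi * B * (t - r / B) = pi * B * t - pi * r" for r :: int
      using assms by (simp add: field_simps)
    then have "pulse B (t - r / B) = of_real (B * cardinal_sine (pi * B * t - pi * r)) * cis (pi * B * t - pi * r)" for r :: int
      by (simp add: pulse_eq)
    moreover have "cis (pi * B * t - pi * p) * cnj (cis (pi * B * t - pi * q)) = cis (pi * (q - p))"
      by (simp add: cis_cnj cis_mult algebra_simps)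
    ultimately show ?thesis
      by (simp add: g_def power2_eq_square mult_ac)
  qed
  have "pi * B \<noteq> 0" using assms by simp
  have "integrable lborel (\<lambda>t. g (0 + pi * B * t))"
    by (rule lborel_integrable_real_affine)
       (use integrable_cardinal_sine_mult_shift \<open>pi * B \<noteq> 0\<close> in \<open>auto simp: g_def[abs_def]\<close>)
  then show "integrable lborel (\<lambda>t. pulse B (t - p / B) * cnj (pulse B (t - q / B)))"
    unfolding eq by (intro integrable_mult_left integrable_of_real)
  have "(LBINT t. g (0 + pi * B * t)) = (LBINT x. g x) / (pi * B)"
    using lborel_integral_real_affine[OF \<open>pi * B \<noteq> 0\<close>, of g 0] assms by simp
  also have "\<dots> = (if p = q then 1 / B else 0)"
    using assms by (simp add: g_def LBINT_cardinal_sine_shift)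
  finally show "(CLBINT t. pulse B (t - p / B) * cnj (pulse B (t - q / B))) = (if p = q then of_real B else 0)"
    unfolding eq using assms
    by (simp add: integral_mult_left_zero integral_complex_of_real power2_eq_square del: add_0)
qed

section \<open>Orthogonality of the characters of Z/N\<close>

text \<open>The sum is geometric with ratio an N-th root of unity \<open>z\<close>. A ratio of 1
  would make \<open>N\<close> divide \<open>j - k\<close>, impossible for distinct \<open>j\<close>
  and \<open>k\<close> below \<open>N\<close>.\<close>

lemma sum_characters:
  fixes j k N :: nat
  assumes "j < N" "k < N"
  shows "(\<Sum>n<N. cis (2 * pi * (real n * real j / real N)) * cnj (cis (2 * pi * (real n * real k / real N))))
       = (if j = k then of_nat N else 0)"
proof -
  define z where "z = cis (2 * pi * ((real j - real k) / N))"
  have "cis (2 * pi * (real n * real j / real N)) * cnj (cis (2 * pi * (real n * real k / real N))) = z ^ n" for n :: nat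
  proof -
    have "2 * pi * (real n * real j / real N) + - (2 * pi * (real n * real k / real N)) = n * (2 * pi * ((real j - real k) / N))"
      using assms by (simp add: field_simps)
    then show ?thesis
      by (simp only: z_def cis_cnj cis_mult Complex.DeMoivre)
  qed
  then have sum: "(\<Sum>n<N. cis (2 * pi * (real n * real j / real N)) * cnj (cis (2 * pi * (real n * real k / real N)))) = (\<Sum>n<N. z ^ n)"
    by simp
  show ?thesis
  proof (cases "j = k")
    case True
    then show ?thesis
      unfolding sum by (simp add: z_def)
  next
    case False
    have "z ^ N = cis (2 * pi * of_int (int j - int k))"
      using assms by (simp add: z_def Complex.DeMoivre)
    also have "\<dots> = 1"
      by (rule cis_multiple_2pi) auto
    finally have "z ^ N = 1" .
    moreover have "z \<noteq> 1"
    proof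
      assume "z = 1"
      then have "cos (2 * pi * ((real j - real k) / N)) = 1"
        by (simp add: z_def complex_eq_iff)
      then obtain i :: int where "2 * pi * ((real j - real k) / N) = i * 2 * pi"
        by (auto simp: cos_one_2pi_int)
      then have "2 * pi * ((real j - real k) / N) = 2 * pi * i"
        by (simp only: mult_ac)
      then have "(real j - real k) / N = i"
        by (rule mult_left_cancel[THEN iffD1, rotated]) simp
      then have "real_of_int (int j - int k) = real_of_int (i * int N)"
        using assms by (simp add: field_simps)
      then have "int j - int k = i * int N"
        by (simp only: of_int_eq_iff)
      then have "int N dvd int j - int k"
        by simp
      then have "int j mod int N = int k mod int N"
        by (simp add: mod_eq_dvd_iff)
      with assms False show False by simp
    qed
    ultimately show ?thesis
      unfolding sum using False by (simp add: geometric_sum)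
  qed
qed

section \<open>Orthonormality of the signals\<close>

lemma alpha_eq:
  assumes "T > 0" "M > 0" "N > 0"
  shows "alpha T (1 / T) M N k l t = of_real (sqrt (T / (real M * real N))) *
    (\<Sum>n<N. cis (2 * pi * (real n * real k / real N)) * pulse (M / T) (t - of_int (int (l + n * M)) / (M / T)))"
proof -
  have "{0..N - 1} = {..<N}" using assms by auto
  moreover have "t - real l * T / real M - real n * T = t - of_int (int (l + n * M)) / (M / T)" for n
    using assms by (simp add: field_simps)
  moreover have "exp (\<i> * 2 * of_real pi * of_real (real n * real k / real N)) = cis (2 * pi * (real n * real k / real N))" for n :: nat
    by (simp add: cis_conv_exp mult_ac)
  moreover have "real M * (1 / T) = M / T" by simp
  ultimately show ?thesis
    by (simp only: alpha_def pulse_def)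
qed

text \<open>Uniqueness of division with remainder by \<open>M\<close>: equal delays force equal
  \<open>l\<close> and equal \<open>n\<close>.\<close>

lemma time_index_eq_iff:
  fixes l1 l2 m n M :: nat
  assumes "l1 < M" "l2 < M"
  shows "l1 + n * M = l2 + m * M \<longleftrightarrow> l1 = l2 \<and> n = m"
proof
  assume eq: "l1 + n * M = l2 + m * M"
  have "(l1 + n * M) mod M = l1" "(l2 + m * M) mod M = l2"
    using assms by simp_all
  with eq have "l1 = l2" by simp
  with eq assms show "l1 = l2 \<and> n = m" by simp
qed simp

lemma
  assumes "T > 0" "k1 < N" "k2 < N" "l1 < M" "l2 < M"
  shows integrable_alpha_mult_cnj_alpha:
      "integrable lborel (\<lambda>t. alpha T (1 / T) M N k1 l1 t * cnj (alpha T (1 / T) M N k2 l2 t))"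
    and CLBINT_alpha_mult_cnj_alpha:
      "(CLBINT t. alpha T (1 / T) M N k1 l1 t * cnj (alpha T (1 / T) M N k2 l2 t))
        = (if k1 = k2 \<and> l1 = l2 then 1 else 0)"
proof -
  define B where "B = M / T"
  define w where "w k n = cis (2 * pi * (real n * real k / real N))" for k n :: nat
  define P where "P n m t = pulse B (t - of_int (int (l1 + n * M)) / B)
      * cnj (pulse B (t - of_int (int (l2 + m * M)) / B))" for n m t
  have pos: "M > 0" "N > 0" "B > 0" using assms by (auto simp: B_def)
  \<comment> \<open>The normalising factor is real, so conjugation fixes it and the two copies
    multiply to its square.\<close>
  have eq: "alpha T (1 / T) M N k1 l1 t * cnj (alpha T (1 / T) M N k2 l2 t)
      = of_real (T / (real M * real N)) * (\<Sum>n<N. \<Sum>m<N. w k1 n * cnj (w k2 m) * P n m t)" for t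
  proof -
    define c where "c = sqrt (T / (real M * real N))"
    have "of_real (T / (real M * real N)) = complex_of_real c * of_real c"
      using assms by (simp add: c_def flip: of_real_mult)
    then have c: "of_real c * x * cnj (of_real c * y) = of_real (T / (real M * real N)) * (x * cnj y)" for x y
      by (simp only: complex_cnj_mult complex_cnj_complex_of_real mult_ac)
    show ?thesis
      unfolding alpha_eq[OF \<open>T > 0\<close> \<open>M > 0\<close> \<open>N > 0\<close>]
      unfolding B_def[symmetric] w_def[symmetric] c_def[symmetric] c
      by (simp only: cnj_sum complex_cnj_mult sum_product P_def mult_ac)
  qed
  have int: "integrable lborel (P n m)" for n m
    unfolding P_def[abs_def] by (rule integrable_pulse_shift[OF \<open>B > 0\<close>])
  have val: "(CLBINT t. P n m t) = (if l1 = l2 \<and> n = m then of_real B else 0)" for n m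
    unfolding P_def CLBINT_pulse_shift[OF \<open>B > 0\<close>] of_nat_eq_iff
    using time_index_eq_iff[OF \<open>l1 < M\<close> \<open>l2 < M\<close>] by simp
  show "integrable lborel (\<lambda>t. alpha T (1 / T) M N k1 l1 t * cnj (alpha T (1 / T) M N k2 l2 t))"
    unfolding eq by (intro integrable_mult_right Bochner_Integration.integrable_sum int)
  have "(CLBINT t. alpha T (1 / T) M N k1 l1 t * cnj (alpha T (1 / T) M N k2 l2 t))
      = of_real (T / (real M * real N)) * (\<Sum>n<N. \<Sum>m<N. w k1 n * cnj (w k2 m) * (CLBINT t. P n m t))"
    unfolding eq
    by (simp add: Bochner_Integration.integral_sum Bochner_Integration.integrable_sum int)
  \<comment> \<open>Orthogonality of the pulses keeps only the diagonal \<open>n = m\<close>, and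
    that only for \<open>l1 = l2\<close>.\<close>
  also have "(\<Sum>n<N. \<Sum>m<N. w k1 n * cnj (w k2 m) * (CLBINT t. P n m t))
      = (if l1 = l2 then of_real B * (\<Sum>n<N. w k1 n * cnj (w k2 n)) else 0)"
    unfolding val by (simp add: if_distrib[of "(*) _"] sum.delta sum_distrib_left mult_ac cong: if_cong)
  also have "(\<Sum>n<N. w k1 n * cnj (w k2 n)) = (if k1 = k2 then of_nat N else 0)"
    unfolding w_def by (rule sum_characters) fact+
  finally show "(CLBINT t. alpha T (1 / T) M N k1 l1 t * cnj (alpha T (1 / T) M N k2 l2 t))
      = (if k1 = k2 \<and> l1 = l2 then 1 else 0)"
    \<comment> \<open>The constants cancel: T / (M N) * (M / T) * N = 1.\<close>
    using assms pos by (simp add: B_def)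
qed

section \<open>Linear independence and dimension\<close>

text \<open>Integrating a vanishing combination against the conjugate of \<open>x j\<close> isolates
  the coefficient of \<open>x j\<close>; \<open>int\<close> justifies exchanging sum and integral.
  If \<open>x i = x j\<close>, the pairing of \<open>x i\<close> with \<open>x j\<close> equals its
  pairing with itself, 1, so \<open>i = j\<close>.\<close>

lemma
  fixes x :: "'i \<Rightarrow> real \<Rightarrow> complex"
  assumes fin: "finite I"
    and int: "\<And>i j. i \<in> I \<Longrightarrow> j \<in> I \<Longrightarrow> integrable lborel (\<lambda>t. x i t * cnj (x j t))"
    and orth: "\<And>i j. i \<in> I \<Longrightarrow> j \<in> I \<Longrightarrow> (CLBINT t. x i t * cnj (x j t)) = (if i = j then 1 else 0)"
  shows orthonormal_inj_on: "inj_on x I"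
    and orthonormal_independent: "signal.independent (x ` I)"
proof -
  show inj: "inj_on x I"
  proof (rule inj_onI)
    fix i j assume "i \<in> I" "j \<in> I" "x i = x j"
    with orth[of i i] orth[of i j] show "i = j"
      by (auto split: if_splits)
  qed
  have "u (x j) = 0" if zero: "(\<Sum>v\<in>x ` I. signal_scale (u v) v) = 0" and "j \<in> I" for u j
  proof -
    \<comment> \<open>Independence speaks of the set of signals, orthonormality of the indexed
      family; injectivity carries the sum from one to the other.\<close>
    have "(\<Sum>v\<in>x ` I. signal_scale (u v) v) t = (\<Sum>i\<in>I. u (x i) * x i t)" for t
    proof -
      have "(\<Sum>v\<in>A. signal_scale (u v) v) t = (\<Sum>v\<in>A. u v * v t)" if "finite A" for A
        using that by (induction A) (auto simp: signal_scale_def)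
      from this[OF finite_imageI[OF fin]] show ?thesis
        using sum.reindex[OF inj, of "\<lambda>v. u v * v t"] by (simp only: o_def)
    qed
    with zero have "(\<Sum>i\<in>I. u (x i) * x i t) = 0" for t
      by simp
    then have "0 = (CLBINT t. (\<Sum>i\<in>I. u (x i) * x i t) * cnj (x j t))"
      by simp
    also have "\<dots> = (CLBINT t. (\<Sum>i\<in>I. u (x i) * (x i t * cnj (x j t))))"
      by (simp add: sum_distrib_right mult.assoc)
    also have "\<dots> = (\<Sum>i\<in>I. u (x i) * (CLBINT t. x i t * cnj (x j t)))"
      using int \<open>j \<in> I\<close> by (simp add: Bochner_Integration.integral_sum)
    also have "\<dots> = u (x j)"
      using fin \<open>j \<in> I\<close> by (simp add: orth if_distrib[of "(*) _"] sum.delta cong: if_cong)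
    finally show ?thesis by simp
  qed
  then show "signal.independent (x ` I)"
    using fin by (auto simp: signal.dependent_finite)
qed

theorem theorem3:
  fixes T \<Delta>f :: real and M N :: nat
  assumes "T > 0" and "\<Delta>f = 1 / T" and "M > 0" and "N > 0"
  defines "\<alpha> \<equiv> alpha T \<Delta>f M N"
    and "I \<equiv> {0..N - 1} \<times> {0..M - 1}"
  shows "(\<forall>k1 \<in> {0..N - 1}. \<forall>k2 \<in> {0..N - 1}. \<forall>l1 \<in> {0..M - 1}. \<forall>l2 \<in> {0..M - 1}.
            integrable lborel (\<lambda>t. \<alpha> k1 l1 t * cnj (\<alpha> k2 l2 t)) \<and>
            (CLBINT t. \<alpha> k1 l1 t * cnj (\<alpha> k2 l2 t))
              = impulse (int k1 - int k2) * impulse (int l1 - int l2))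
       \<and> inj_on (\<lambda>(k, l). \<alpha> k l) I
       \<and> signal.independent ((\<lambda>(k, l). \<alpha> k l) ` I)
       \<and> signal.dim (signal.span ((\<lambda>(k, l). \<alpha> k l) ` I)) = M * N"
proof -
  \<comment> \<open>Integrability accompanies each value, since the Bochner integral of a
    non-integrable function is 0 by convention and a zero alone would not show
    orthogonality.\<close>
  have int: "integrable lborel (\<lambda>t. \<alpha> k1 l1 t * cnj (\<alpha> k2 l2 t))"
    and orth: "(CLBINT t. \<alpha> k1 l1 t * cnj (\<alpha> k2 l2 t)) = (if k1 = k2 \<and> l1 = l2 then 1 else 0)"
    if "(k1, l1) \<in> I" "(k2, l2) \<in> I" for k1 k2 l1 l2
  proof -
    have "k1 < N" "k2 < N" "l1 < M" "l2 < M"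
      using that \<open>M > 0\<close> \<open>N > 0\<close> by (auto simp: I_def)
    then show "integrable lborel (\<lambda>t. \<alpha> k1 l1 t * cnj (\<alpha> k2 l2 t))"
      and "(CLBINT t. \<alpha> k1 l1 t * cnj (\<alpha> k2 l2 t)) = (if k1 = k2 \<and> l1 = l2 then 1 else 0)"
      unfolding \<alpha>_def \<open>\<Delta>f = 1 / T\<close>
      using \<open>T > 0\<close>
      by (simp_all only: integrable_alpha_mult_cnj_alpha CLBINT_alpha_mult_cnj_alpha)
  qed
  have fin: "finite I" by (simp add: I_def)
  have int': "integrable lborel (\<lambda>t. (case i of (k, l) \<Rightarrow> \<alpha> k l) t * cnj ((case j of (k, l) \<Rightarrow> \<alpha> k l) t))"
    and orth': "(CLBINT t. (case i of (k, l) \<Rightarrow> \<alpha> k l) t * cnj ((case j of (k, l) \<Rightarrow> \<alpha> k l) t)) = (if i = j then 1 else 0)"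
    if "i \<in> I" "j \<in> I" for i j
    using that int orth by (cases i; cases j; simp)+
  note inj = orthonormal_inj_on[OF fin int' orth'] and ind = orthonormal_independent[OF fin int' orth']
  have "card I = M * N"
    using \<open>M > 0\<close> \<open>N > 0\<close> by (simp add: I_def)
  \<comment> \<open>An independent set has as many elements as its span has dimensions, and
    injectivity gives the image the cardinality of \<open>I\<close>.\<close>
  then have "signal.dim (signal.span ((\<lambda>(k, l). \<alpha> k l) ` I)) = M * N"
    by (simp only: signal.dim_span_eq_card_independent[OF ind] card_image[OF inj])
  moreover have "\<forall>k1 \<in> {0..N - 1}. \<forall>k2 \<in> {0..N - 1}. \<forall>l1 \<in> {0..M - 1}. \<forall>l2 \<in> {0..M - 1}.
      integrable lborel (\<lambda>t. \<alpha> k1 l1 t * cnj (\<alpha> k2 l2 t)) \<and>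
      (CLBINT t. \<alpha> k1 l1 t * cnj (\<alpha> k2 l2 t)) = impulse (int k1 - int k2) * impulse (int l1 - int l2)"
    using int orth by (simp add: I_def impulse_def)
  ultimately show ?thesis
    using inj ind by blast
qed

end
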